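(* Let $M$ be a $G$-graded $R$-module. Then $\mathrm{Spec}_G^s(M)$ with the Zariski topology is a Noetherian topological space if and only if the descending chain condition holds for graded Zariski socle submodules of $M$.
   Context: $G$ is an abelian group with identity $e$; all rings are commutative with unity $1$. A $G$-graded ring is a ring $R=\bigoplus_{g\in G}R_g$ with additive subgroups $R_g$ satisfying $R_gR_h\subseteq R_{gh}$; $h(R)=\bigcup_{g}R_g$. A $G$-graded $R$-module is an $R$-module $M=\bigoplus_{g\in G}M_g$ with $R_gM_h\subseteq M_{gh}$; a submodule $N$ is graded ($N\leq_G M$) if $N=\bigoplus_g(N\cap M_g)$. $Ann_R(N)=\{r\in R: rN=0\}$. A non-zero graded submodule $S$ of $M$ is graded second if for every $r\in h(R)$, $rS=S$ or $rS=0$; $\mathrm{Spec}_G^s(M)$ is the set of all graded second submodules of $M$. For $N\leq_G M$, $V_G^s(N)=\{S\in \mathrm{Spec}_G^s(M): Ann_R(N)\subseteq Ann_R(S)\}$; the sets $V_G^s(N)$, $N\leq_G M$, are the closed sets of the Zariski topology on $\mathrm{Spec}_G^s(M)$. The graded Zariski socle $Z.soc_G(N)$ is the sum of all members of $V_G^s(N)$ ($\{0\}$ if $V_G^s(N)=\emptyset$). $N$ is a graded Zariski socle submodule if $N=Z.soc_G(N)$. A topological space is Noetherian if its closed sets satisfy the descending chain condition. *)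

theory Defs
  imports "HOL-Algebra.Module" "HOL-Analysis.Abstract_Topology"
begin

text \<open>\<open>W\<close> is the internal direct sum of the additive subgroups \<open>A i\<close>: summation is a bijection
  from the families \<open>f i \<in> A i\<close> of finite support (the direct sum) onto \<open>W\<close>.\<close>

definition internal_direct_sum ::
  "('a, 'c) ring_scheme \<Rightarrow> 'g set \<Rightarrow> ('g \<Rightarrow> 'a set) \<Rightarrow> 'a set \<Rightarrow> bool" where
  "internal_direct_sum M I A W \<longleftrightarrow>
     (\<forall>i\<in>I. subgroup (A i) (add_monoid M)) \<and>
     bij_betw (\<lambda>f. \<Oplus>\<^bsub>M\<^esub>i\<in>{i\<in>I. f i \<noteq> \<zero>\<^bsub>M\<^esub>}. f i)
       {f \<in> (\<Pi>\<^sub>E i\<in>I. A i). finite {i\<in>I. f i \<noteq> \<zero>\<^bsub>M\<^esub>}} W"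

locale graded_ring = G: comm_group G + R: cring R
  for G :: "('g, 'c) monoid_scheme" and R :: "('r, 'd) ring_scheme" +
  fixes A :: "'g \<Rightarrow> 'r set"
  assumes ring_direct_sum: "internal_direct_sum R (carrier G) A (carrier R)"
    and ring_mult: "\<lbrakk>g \<in> carrier G; h \<in> carrier G; r \<in> A g; s \<in> A h\<rbrakk>
      \<Longrightarrow> r \<otimes>\<^bsub>R\<^esub> s \<in> A (g \<otimes>\<^bsub>G\<^esub> h)"

locale graded_module = graded_ring G R A + M: Module.module R M
  for G :: "('g, 'c) monoid_scheme" and R :: "('r, 'd) ring_scheme" and A :: "'g \<Rightarrow> 'r set"
    and M :: "('r, 'm, 'e) module_scheme" +
  fixes B :: "'g \<Rightarrow> 'm set"
  assumes module_direct_sum: "internal_direct_sum M (carrier G) B (carrier M)"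
    and module_smult: "\<lbrakk>g \<in> carrier G; h \<in> carrier G; r \<in> A g; x \<in> B h\<rbrakk>
      \<Longrightarrow> r \<odot>\<^bsub>M\<^esub> x \<in> B (g \<otimes>\<^bsub>G\<^esub> h)"

definition homogeneous :: "('g, 'c) monoid_scheme \<Rightarrow> ('g \<Rightarrow> 'r set) \<Rightarrow> 'r set" where
  "homogeneous G A = (\<Union>g\<in>carrier G. A g)"

definition graded_submodule ::
  "('g, 'c) monoid_scheme \<Rightarrow> ('r, 'd) ring_scheme \<Rightarrow> ('r, 'm, 'e) module_scheme
    \<Rightarrow> ('g \<Rightarrow> 'm set) \<Rightarrow> 'm set \<Rightarrow> bool" where
  "graded_submodule G R M B N \<longleftrightarrow>
     submodule N R M \<and> internal_direct_sum M (carrier G) (\<lambda>g. N \<inter> B g) N"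

definition Ann :: "('r, 'd) ring_scheme \<Rightarrow> ('r, 'm, 'e) module_scheme \<Rightarrow> 'm set \<Rightarrow> 'r set" where
  "Ann R M N = {r \<in> carrier R. \<forall>n\<in>N. r \<odot>\<^bsub>M\<^esub> n = \<zero>\<^bsub>M\<^esub>}"

definition graded_second ::
  "('g, 'c) monoid_scheme \<Rightarrow> ('r, 'd) ring_scheme \<Rightarrow> ('g \<Rightarrow> 'r set)
    \<Rightarrow> ('r, 'm, 'e) module_scheme \<Rightarrow> ('g \<Rightarrow> 'm set) \<Rightarrow> 'm set \<Rightarrow> bool" where
  "graded_second G R A M B S \<longleftrightarrow>
     graded_submodule G R M B S \<and> S \<noteq> {\<zero>\<^bsub>M\<^esub>} \<and>
     (\<forall>r\<in>homogeneous G A. (\<lambda>x. r \<odot>\<^bsub>M\<^esub> x) ` S = S \<or> (\<lambda>x. r \<odot>\<^bsub>M\<^esub> x) ` S = {\<zero>\<^bsub>M\<^esub>})"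

definition second_spec ::
  "('g, 'c) monoid_scheme \<Rightarrow> ('r, 'd) ring_scheme \<Rightarrow> ('g \<Rightarrow> 'r set)
    \<Rightarrow> ('r, 'm, 'e) module_scheme \<Rightarrow> ('g \<Rightarrow> 'm set) \<Rightarrow> 'm set set" where
  "second_spec G R A M B = {S. graded_second G R A M B S}"

definition second_variety ::
  "('g, 'c) monoid_scheme \<Rightarrow> ('r, 'd) ring_scheme \<Rightarrow> ('g \<Rightarrow> 'r set)
    \<Rightarrow> ('r, 'm, 'e) module_scheme \<Rightarrow> ('g \<Rightarrow> 'm set) \<Rightarrow> 'm set \<Rightarrow> 'm set set" where
  "second_variety G R A M B N = {S \<in> second_spec G R A M B. Ann R M N \<subseteq> Ann R M S}"

text \<open>The topology whose closed sets are exactly the sets \<^term>\<open>second_variety G R A M B N\<close>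
  for graded submodules \<open>N\<close>.\<close>

definition zariski_topology ::
  "('g, 'c) monoid_scheme \<Rightarrow> ('r, 'd) ring_scheme \<Rightarrow> ('g \<Rightarrow> 'r set)
    \<Rightarrow> ('r, 'm, 'e) module_scheme \<Rightarrow> ('g \<Rightarrow> 'm set) \<Rightarrow> 'm set topology" where
  "zariski_topology G R A M B =
     topology (\<lambda>U. \<exists>N. graded_submodule G R M B N \<and>
                        U = second_spec G R A M B - second_variety G R A M B N)"

text \<open>The sum of a family of submodules: all finite sums of elements of its members. In particular
  the sum of the empty family is the zero submodule.\<close>

definition submodule_sum :: "('r, 'm, 'e) module_scheme \<Rightarrow> 'm set set \<Rightarrow> 'm set" where
  "submodule_sum M \<N> =
     {\<Oplus>\<^bsub>M\<^esub>S\<in>F. f S | F f. finite F \<and> F \<subseteq> \<N> \<and> f \<in> (\<Pi> S\<in>F. S)}"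

definition zariski_socle ::
  "('g, 'c) monoid_scheme \<Rightarrow> ('r, 'd) ring_scheme \<Rightarrow> ('g \<Rightarrow> 'r set)
    \<Rightarrow> ('r, 'm, 'e) module_scheme \<Rightarrow> ('g \<Rightarrow> 'm set) \<Rightarrow> 'm set \<Rightarrow> 'm set" where
  "zariski_socle G R A M B N = submodule_sum M (second_variety G R A M B N)"

definition zariski_socle_submodule ::
  "('g, 'c) monoid_scheme \<Rightarrow> ('r, 'd) ring_scheme \<Rightarrow> ('g \<Rightarrow> 'r set)
    \<Rightarrow> ('r, 'm, 'e) module_scheme \<Rightarrow> ('g \<Rightarrow> 'm set) \<Rightarrow> 'm set \<Rightarrow> bool" where
  "zariski_socle_submodule G R A M B N \<longleftrightarrow>
     graded_submodule G R M B N \<and> N = zariski_socle G R A M B N"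

definition descending_chain_condition :: "'a set set \<Rightarrow> bool" where
  "descending_chain_condition \<A> \<longleftrightarrow>
     (\<forall>C :: nat \<Rightarrow> 'a set. range C \<subseteq> \<A> \<and> decseq C \<longrightarrow> (\<exists>n. \<forall>m\<ge>n. C m = C n))"

definition noetherian_space :: "'a topology \<Rightarrow> bool" where
  "noetherian_space X \<longleftrightarrow> descending_chain_condition {C. closedin X C}"

end

theory Submission imports Defs begin

text \<open>
  For every set \<open>C\<close> of graded second submodules, the annihilator of \<open>\<Sum>C\<close> is the intersection of
  the annihilators of the members of \<open>C\<close>. Hence \<open>V(\<Sum>C) \<supseteq> C\<close>, with equality when \<open>C\<close> is an
  intersection or a finite union of varieties; for unions one uses that the annihilator of a graded
  second submodule is graded prime. So \<open>C \<mapsto> \<Sum>C\<close> and \<open>N \<mapsto> V(N)\<close> are mutually inverse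
  order isomorphisms between the closed sets and the graded Zariski socle submodules, and the
  descending chain condition passes from one side to the other.
\<close>

section \<open>Components in a direct sum\<close>

text \<open>Only the additive structure matters here, so the same facts serve for the grading of the
  ring and for that of the module.\<close>

locale direct_sum = abelian_group M for M (structure) +
  fixes I :: "'i set" and B :: "'i \<Rightarrow> 'a set"
  assumes decomposition: "internal_direct_sum M I B (carrier M)"
begin

definition families :: "('i \<Rightarrow> 'a) set" where
  "families = {f \<in> (\<Pi>\<^sub>E i\<in>I. B i). finite {i\<in>I. f i \<noteq> \<zero>}}"

text \<open>Since the decomposition is given as a bijection from families onto the carrier,
  components are read off its inverse; they are meaningful for \<open>x\<close> in the carrier and
  \<open>i\<close> in \<open>I\<close>.\<close>

definition component :: "'a \<Rightarrow> 'i \<Rightarrow> 'a" where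
  "component = inv_into families (\<lambda>f. \<Oplus>i\<in>{i\<in>I. f i \<noteq> \<zero>}. f i)"

lemma summand_subgroup: "i \<in> I \<Longrightarrow> subgroup (B i) (add_monoid M)"
  using decomposition by (simp add: internal_direct_sum_def)

lemma summand_closed: "i \<in> I \<Longrightarrow> x \<in> B i \<Longrightarrow> x \<in> carrier M"
  using subgroup.subset[OF summand_subgroup] by auto

lemma zero_in_summand: "i \<in> I \<Longrightarrow> \<zero> \<in> B i"
  using subgroup.one_closed[OF summand_subgroup] by simp

lemma add_in_summand: "i \<in> I \<Longrightarrow> x \<in> B i \<Longrightarrow> y \<in> B i \<Longrightarrow> x \<oplus> y \<in> B i"
  using subgroup.m_closed[OF summand_subgroup] by simp

lemma sum_bij_betw:
  "bij_betw (\<lambda>f. \<Oplus>i\<in>{i\<in>I. f i \<noteq> \<zero>}. f i) families (carrier M)"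
  using decomposition by (simp add: internal_direct_sum_def families_def)

lemma component_in_families: "x \<in> carrier M \<Longrightarrow> component x \<in> families"
  unfolding component_def
  by (rule inv_into_into) (simp add: bij_betw_imp_surj_on[OF sum_bij_betw])

lemma component_mem: "x \<in> carrier M \<Longrightarrow> i \<in> I \<Longrightarrow> component x i \<in> B i"
  using component_in_families unfolding families_def by auto

lemma component_closed [simp]: "x \<in> carrier M \<Longrightarrow> i \<in> I \<Longrightarrow> component x i \<in> carrier M"
  using component_mem summand_closed by blast

lemma finite_support: "x \<in> carrier M \<Longrightarrow> finite {i\<in>I. component x i \<noteq> \<zero>}"
  using component_in_families unfolding families_def by auto

lemma sum_components: "x \<in> carrier M \<Longrightarrow> (\<Oplus>i\<in>{i\<in>I. component x i \<noteq> \<zero>}. component x i) = x"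
  using bij_betw_inv_into_right[OF sum_bij_betw] by (simp add: component_def)

text \<open>This is uniqueness of the decomposition: any finite sum with one term from each of
  distinct summands already is the decomposition of its value.\<close>

lemma component_finsum_summands:
  assumes F: "finite F" "F \<subseteq> I" and f: "\<And>i. i \<in> F \<Longrightarrow> f i \<in> B i" and i: "i \<in> I"
  shows "component (\<Oplus>i\<in>F. f i) i = (if i \<in> F then f i else \<zero>)"
proof -
  \<comment> \<open>Members of \<open>families\<close> are extensional functions on all of
    \<open>I\<close>, so \<open>f\<close> is extended by zero outside \<open>F\<close> and then
    restricted to \<open>I\<close>.\<close>
  define h where "h = (\<lambda>i\<in>I. if i \<in> F then f i else \<zero>)"
  have sub: "{i\<in>I. h i \<noteq> \<zero>} \<subseteq> F"
    by (auto simp: h_def split: if_splits)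
  have h: "h \<in> families"
    using f zero_in_summand finite_subset[OF sub F(1)] by (auto simp: families_def h_def)
  have fc: "f \<in> F \<rightarrow> carrier M"
    using f F(2) summand_closed by blast
  have "(\<Oplus>i\<in>{i\<in>I. h i \<noteq> \<zero>}. h i) = (\<Oplus>i\<in>F. f i)"
    by (rule add.finprod_mono_neutral_cong_left[OF F(1) sub])
      (use F(2) fc in \<open>auto simp: h_def split: if_splits\<close>)
  then have "component (\<Oplus>i\<in>F. f i) = h"
    using bij_betw_inv_into_left[OF sum_bij_betw h] by (simp add: component_def)
  then show ?thesis
    using i by (simp add: h_def)
qed

lemma component_summand:
  assumes "j \<in> I" "x \<in> B j" "i \<in> I"
  shows "component x i = (if i = j then x else \<zero>)"
  using component_finsum_summands[of "{j}" "\<lambda>_. x" i] assms summand_closed[OF assms(1,2)]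
  by simp

lemma component_zero [simp]: "i \<in> I \<Longrightarrow> component \<zero> i = \<zero>"
  using component_summand[of i \<zero> i] zero_in_summand by simp

lemma sum_components_superset:
  assumes "x \<in> carrier M" "finite F" "F \<subseteq> I" "{i\<in>I. component x i \<noteq> \<zero>} \<subseteq> F"
  shows "(\<Oplus>i\<in>F. component x i) = x"
proof -
  have "(\<Oplus>i\<in>{i\<in>I. component x i \<noteq> \<zero>}. component x i) = (\<Oplus>i\<in>F. component x i)"
    by (rule add.finprod_mono_neutral_cong_left) (use assms in auto)
  then show ?thesis
    using sum_components[OF assms(1)] by simp
qed

text \<open>Over the union of the two supports, adding the components termwise gives a decomposition
  of the sum, and decompositions are unique.\<close>

lemma component_add:
  assumes x: "x \<in> carrier M" and y: "y \<in> carrier M" and i: "i \<in> I"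
  shows "component (x \<oplus> y) i = component x i \<oplus> component y i"
proof -
  let ?F = "{i\<in>I. component x i \<noteq> \<zero>} \<union> {i\<in>I. component y i \<noteq> \<zero>}"
  have F: "finite ?F" "?F \<subseteq> I"
    using finite_support x y by auto
  have "(\<Oplus>i\<in>?F. component x i \<oplus> component y i)
      = (\<Oplus>i\<in>?F. component x i) \<oplus> (\<Oplus>i\<in>?F. component y i)"
    by (rule finsum_addf) (use F(2) x y in auto)
  also have "\<dots> = x \<oplus> y"
    using sum_components_superset[OF x F] sum_components_superset[OF y F] by auto
  finally have sum: "(\<Oplus>i\<in>?F. component x i \<oplus> component y i) = x \<oplus> y" .
  have "component (\<Oplus>i\<in>?F. component x i \<oplus> component y i) i
      = (if i \<in> ?F then component x i \<oplus> component y i else \<zero>)"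
  proof (rule component_finsum_summands[OF F _ i])
    fix j assume "j \<in> ?F"
    then have "j \<in> I"
      by auto
    then show "component x j \<oplus> component y j \<in> B j"
      using add_in_summand component_mem x y by blast
  qed
  then show ?thesis
    unfolding sum using i by (auto split: if_splits)
qed

lemma component_finsum:
  assumes "finite F" "f \<in> F \<rightarrow> carrier M" "i \<in> I"
  shows "component (\<Oplus>j\<in>F. f j) i = (\<Oplus>j\<in>F. component (f j) i)"
  using assms(1,2)
proof induction
  case (insert j F)
  then have "f j \<in> carrier M" "\<And>k. k \<in> F \<Longrightarrow> f k \<in> carrier M"
    by auto
  with insert assms(3) show ?case
    by (simp add: component_add)
qed (simp add: assms(3))

lemma subgroup_finsum_closed:
  assumes "subgroup N (add_monoid M)" "finite F" "\<And>i. i \<in> F \<Longrightarrow> f i \<in> N"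
  shows "(\<Oplus>i\<in>F. f i) \<in> N"
  using assms(2,3)
proof induction
  case empty
  then show ?case
    using subgroup.one_closed[OF assms(1)] by simp
next
  case (insert i F)
  then have "f \<in> F \<rightarrow> carrier M" "f i \<in> carrier M"
    using subgroup.subset[OF assms(1)] by auto
  with insert show ?case
    using subgroup.m_closed[OF assms(1)] by simp
qed

text \<open>Injectivity of summation is inherited from \<open>M\<close>, and its values stay in the
  subgroup \<open>N\<close>. Only surjectivity onto \<open>N\<close> is at stake, and the only
  possible preimage of \<open>x\<close> is \<open>component x\<close>. This turns gradedness into a
  closure property.\<close>

lemma internal_direct_sum_Int_iff:
  assumes N: "subgroup N (add_monoid M)"
  shows "internal_direct_sum M I (\<lambda>i. N \<inter> B i) N \<longleftrightarrow> (\<forall>x\<in>N. \<forall>i\<in>I. component x i \<in> N)"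
proof -
  let ?\<phi> = "\<lambda>f. \<Oplus>i\<in>{i\<in>I. f i \<noteq> \<zero>}. f i"
  let ?X = "{f \<in> (\<Pi>\<^sub>E i\<in>I. N \<inter> B i). finite {i\<in>I. f i \<noteq> \<zero>}}"
  have NM: "N \<subseteq> carrier M"
    using subgroup.subset[OF N] by simp
  have X: "?X \<subseteq> families"
    by (auto simp: families_def PiE_iff)
  have comp: "component (?\<phi> f) = f" if "f \<in> families" for f
    using bij_betw_inv_into_left[OF sum_bij_betw that] by (simp add: component_def)
  have inj: "inj_on ?\<phi> ?X"
    using inj_on_subset[OF bij_betw_imp_inj_on[OF sum_bij_betw] X] .
  have into: "?\<phi> ` ?X \<subseteq> N"
    using subgroup_finsum_closed[OF N] by (auto simp: PiE_iff)
  have "internal_direct_sum M I (\<lambda>i. N \<inter> B i) N \<longleftrightarrow> N \<subseteq> ?\<phi> ` ?X"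
    using add.subgroups_Inter_pair[OF N summand_subgroup] inj into
    unfolding internal_direct_sum_def bij_betw_def by blast
  also have "\<dots> \<longleftrightarrow> (\<forall>x\<in>N. \<forall>i\<in>I. component x i \<in> N)"
  proof
    assume sub: "N \<subseteq> ?\<phi> ` ?X"
    show "\<forall>x\<in>N. \<forall>i\<in>I. component x i \<in> N"
    proof (intro ballI)
      fix x i assume "x \<in> N" "i \<in> I"
      then obtain f where f: "f \<in> ?X" "x = ?\<phi> f"
        using sub by blast
      then show "component x i \<in> N"
        using comp[of f] X \<open>i \<in> I\<close> by (auto simp: PiE_iff)
    qed
  next
    assume closed: "\<forall>x\<in>N. \<forall>i\<in>I. component x i \<in> N"
    show "N \<subseteq> ?\<phi> ` ?X"
    proof
      fix x assume "x \<in> N"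
      then have "component x \<in> ?X"
        using closed component_in_families[of x] NM by (auto simp: families_def PiE_iff)
      moreover have "x = ?\<phi> (component x)"
        using sum_components[of x] \<open>x \<in> N\<close> NM by auto
      ultimately show "x \<in> ?\<phi> ` ?X"
        by blast
    qed
  qed
  finally show ?thesis .
qed

end

section \<open>Graded second submodules\<close>

context graded_module
begin

sublocale RD: direct_sum R "carrier G" A
  by unfold_locales (rule ring_direct_sum)

sublocale MD: direct_sum M "carrier G" B
  by unfold_locales (rule module_direct_sum)

lemma finsum_smult_rdistr:
  assumes "finite F" "f \<in> F \<rightarrow> carrier R" "x \<in> carrier M"
  shows "(\<Oplus>\<^bsub>R\<^esub>i\<in>F. f i) \<odot>\<^bsub>M\<^esub> x = (\<Oplus>\<^bsub>M\<^esub>i\<in>F. f i \<odot>\<^bsub>M\<^esub> x)"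
  using assms(1,2)
proof induction
  case (insert i F)
  then have "f i \<in> carrier R" "\<And>k. k \<in> F \<Longrightarrow> f k \<in> carrier R"
    by auto
  with insert assms(3) show ?case
    by (simp add: M.smult_l_distr)
qed (simp add: assms(3))

text \<open>Acting on \<open>x\<close> of degree \<open>h\<close> shifts the degree of each
  component of \<open>r\<close> by \<open>h\<close>. By cancellation in the group, the only
  component of \<open>r\<close> that lands in degree \<open>gh\<close> is the one of degree
  \<open>g\<close>.\<close>

lemma component_smult:
  assumes r: "r \<in> carrier R" and g: "g \<in> carrier G" and h: "h \<in> carrier G" and x: "x \<in> B h"
  shows "MD.component (r \<odot>\<^bsub>M\<^esub> x) (g \<otimes>\<^bsub>G\<^esub> h) = RD.component r g \<odot>\<^bsub>M\<^esub> x"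
proof -
  \<comment> \<open>The index \<open>g\<close> is inserted by hand because the component of
    \<open>r\<close> there may vanish, while the sum is later collapsed to its term at
    \<open>g\<close>.\<close>
  define F where "F = insert g {k \<in> carrier G. RD.component r k \<noteq> \<zero>\<^bsub>R\<^esub>}"
  have F: "finite F" "F \<subseteq> carrier G"
    using RD.finite_support[OF r] g by (auto simp: F_def)
  have xM: "x \<in> carrier M"
    using MD.summand_closed h x by blast
  have rF: "RD.component r \<in> F \<rightarrow> carrier R"
    using F(2) r by auto
  have rx: "RD.component r k \<odot>\<^bsub>M\<^esub> x \<in> carrier M" if "k \<in> F" for k
    using rF xM that by auto
  have comp: "MD.component (RD.component r k \<odot>\<^bsub>M\<^esub> x) (g \<otimes>\<^bsub>G\<^esub> h)
      = (if g = k then RD.component r k \<odot>\<^bsub>M\<^esub> x else \<zero>\<^bsub>M\<^esub>)" if "k \<in> F" for k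
  proof -
    have k: "k \<in> carrier G"
      using F that by auto
    have "RD.component r k \<odot>\<^bsub>M\<^esub> x \<in> B (k \<otimes>\<^bsub>G\<^esub> h)"
      using module_smult[OF k h RD.component_mem[OF r k] x] .
    then show ?thesis
      using MD.component_summand[of "k \<otimes>\<^bsub>G\<^esub> h" _ "g \<otimes>\<^bsub>G\<^esub> h"] g h k by simp
  qed
  have "(\<Oplus>\<^bsub>R\<^esub>k\<in>F. RD.component r k) = r"
    by (rule RD.sum_components_superset[OF r F]) (auto simp: F_def)
  then have "r \<odot>\<^bsub>M\<^esub> x = (\<Oplus>\<^bsub>R\<^esub>k\<in>F. RD.component r k) \<odot>\<^bsub>M\<^esub> x"
    by simp
  also have "\<dots> = (\<Oplus>\<^bsub>M\<^esub>k\<in>F. RD.component r k \<odot>\<^bsub>M\<^esub> x)"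
    by (rule finsum_smult_rdistr[OF F(1) rF xM])
  finally have "MD.component (r \<odot>\<^bsub>M\<^esub> x) (g \<otimes>\<^bsub>G\<^esub> h)
      = (\<Oplus>\<^bsub>M\<^esub>k\<in>F. MD.component (RD.component r k \<odot>\<^bsub>M\<^esub> x) (g \<otimes>\<^bsub>G\<^esub> h))"
    using MD.component_finsum[OF F(1), of "\<lambda>k. RD.component r k \<odot>\<^bsub>M\<^esub> x"] rF xM g h
    by (simp add: Pi_iff)
  also have "\<dots> = (\<Oplus>\<^bsub>M\<^esub>k\<in>F. if g = k then RD.component r k \<odot>\<^bsub>M\<^esub> x else \<zero>\<^bsub>M\<^esub>)"
    by (rule M.M.finsum_cong') (use comp rx in auto)
  also have "\<dots> = RD.component r g \<odot>\<^bsub>M\<^esub> x"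
    by (rule M.M.finsum_singleton) (use F(1) rx in \<open>auto simp: F_def\<close>)
  finally show ?thesis .
qed

lemma graded_submodule_iff:
  "graded_submodule G R M B N \<longleftrightarrow>
     submodule N R M \<and> (\<forall>x\<in>N. \<forall>g\<in>carrier G. MD.component x g \<in> N)"
  unfolding graded_submodule_def
  using MD.internal_direct_sum_Int_iff submodule.axioms(1) by blast

section \<open>Annihilators of graded and of graded second submodules\<close>

lemma submodule_closed: "submodule N R M \<Longrightarrow> x \<in> N \<Longrightarrow> x \<in> carrier M"
  using M.submoduleE(1) by blast

lemma submodule_zero: "submodule N R M \<Longrightarrow> \<zero>\<^bsub>M\<^esub> \<in> N"
  using subgroup.one_closed[OF submodule.axioms(1)] by fastforce

text \<open>The annihilator of a graded submodule is a graded ideal. The components of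
  \<open>n\<close> stay in \<open>N\<close>, so \<open>r\<close> kills each of them. By
  \<open>component_smult\<close>, the part of degree \<open>gh\<close> of the product of
  \<open>r\<close> with the component of \<open>n\<close> at \<open>h\<close> is the product of the
  two components, so it vanishes. Summing over \<open>h\<close> gives the claim for
  \<open>n\<close>.\<close>

lemma component_in_Ann:
  assumes N: "graded_submodule G R M B N" and r: "r \<in> Ann R M N" and g: "g \<in> carrier G"
  shows "RD.component r g \<in> Ann R M N"
proof -
  have rR: "r \<in> carrier R"
    using r by (simp add: Ann_def)
  have "RD.component r g \<odot>\<^bsub>M\<^esub> n = \<zero>\<^bsub>M\<^esub>" if n: "n \<in> N" for n
  proof -
    let ?F = "{h \<in> carrier G. MD.component n h \<noteq> \<zero>\<^bsub>M\<^esub>}"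
    have nM: "n \<in> carrier M"
      using N n submodule_closed graded_submodule_def by metis
    have "RD.component r g \<odot>\<^bsub>M\<^esub> n = RD.component r g \<odot>\<^bsub>M\<^esub> (\<Oplus>\<^bsub>M\<^esub>h\<in>?F. MD.component n h)"
      using MD.sum_components[OF nM] by simp
    also have "\<dots> = (\<Oplus>\<^bsub>M\<^esub>h\<in>?F. RD.component r g \<odot>\<^bsub>M\<^esub> MD.component n h)"
      by (rule M.finsum_smult_ldistr) (use MD.finite_support[OF nM] rR g nM in auto)
    also have "\<dots> = (\<Oplus>\<^bsub>M\<^esub>h\<in>?F. \<zero>\<^bsub>M\<^esub>)"
    proof (rule M.M.finsum_cong')
      fix h assume "h \<in> ?F"
      then have h: "h \<in> carrier G"
        by simp
      then have "r \<odot>\<^bsub>M\<^esub> MD.component n h = \<zero>\<^bsub>M\<^esub>"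
        using N n r by (auto simp: graded_submodule_iff Ann_def)
      then show "RD.component r g \<odot>\<^bsub>M\<^esub> MD.component n h = \<zero>\<^bsub>M\<^esub>"
        using component_smult[OF rR g h MD.component_mem[OF nM h]] g h by simp
    qed auto
    finally show ?thesis
      by simp
  qed
  then show ?thesis
    using rR g by (simp add: Ann_def)
qed

text \<open>Used in contrapositive form: a scalar that does not annihilate \<open>N\<close> has a
  homogeneous component that does not annihilate \<open>N\<close>.\<close>

lemma Ann_if_components:
  assumes "r \<in> carrier R" "N \<subseteq> carrier M" "\<And>g. g \<in> carrier G \<Longrightarrow> RD.component r g \<in> Ann R M N"
  shows "r \<in> Ann R M N"
proof -
  let ?F = "{g \<in> carrier G. RD.component r g \<noteq> \<zero>\<^bsub>R\<^esub>}"
  have "r \<odot>\<^bsub>M\<^esub> n = \<zero>\<^bsub>M\<^esub>" if n: "n \<in> N" for n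
  proof -
    have nM: "n \<in> carrier M"
      using n assms(2) by auto
    have "r \<odot>\<^bsub>M\<^esub> n = (\<Oplus>\<^bsub>R\<^esub>g\<in>?F. RD.component r g) \<odot>\<^bsub>M\<^esub> n"
      using RD.sum_components[OF assms(1)] by simp
    also have "\<dots> = (\<Oplus>\<^bsub>M\<^esub>g\<in>?F. RD.component r g \<odot>\<^bsub>M\<^esub> n)"
      by (rule finsum_smult_rdistr) (use RD.finite_support[OF assms(1)] assms(1) nM in auto)
    also have "\<dots> = (\<Oplus>\<^bsub>M\<^esub>g\<in>?F. \<zero>\<^bsub>M\<^esub>)"
      by (rule M.M.finsum_cong') (use assms(3) n in \<open>auto simp: Ann_def\<close>)
    finally show ?thesis
      by simp
  qed
  with assms(1) show ?thesis
    by (simp add: Ann_def)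
qed

lemma Ann_antimono: "N \<subseteq> N' \<Longrightarrow> Ann R M N' \<subseteq> Ann R M N"
  by (auto simp: Ann_def)

lemma mult_in_Ann:
  assumes "submodule N R M" "a \<in> carrier R" "b \<in> Ann R M N"
  shows "a \<otimes>\<^bsub>R\<^esub> b \<in> Ann R M N"
  using assms submodule_closed[OF assms(1)] by (auto simp: Ann_def M.smult_assoc1)

text \<open>If both inclusions fail, there are \<open>a\<close> in \<open>Ann R M N\<close> and a
  homogeneous \<open>b\<close> in \<open>Ann R M N'\<close>, neither of which kills
  \<open>S\<close>. Their product lies in both annihilators, hence kills \<open>S\<close>. But
  \<open>S\<close> is second and \<open>b\<close> does not kill it, so \<open>bS = S\<close> and
  \<open>aS = abS = 0\<close>, a contradiction.\<close>

lemma Ann_graded_second_prime: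
  assumes S: "graded_second G R A M B S"
    and N: "graded_submodule G R M B N" and N': "graded_submodule G R M B N'"
    and sub: "Ann R M N \<inter> Ann R M N' \<subseteq> Ann R M S"
  shows "Ann R M N \<subseteq> Ann R M S \<or> Ann R M N' \<subseteq> Ann R M S"
proof (rule ccontr)
  have SM: "submodule S R M"
    using S by (simp add: graded_second_def graded_submodule_def)
  have SC: "S \<subseteq> carrier M"
    using submodule_closed[OF SM] by blast
  \<comment> \<open>Secondness speaks of homogeneous scalars only, so a witness of non-inclusion is
    replaced by one of its components, which stays in the annihilator of \<open>K\<close> because
    \<open>K\<close> is graded.\<close>
  have homog: "\<exists>a\<in>homogeneous G A. a \<in> Ann R M K \<and> a \<notin> Ann R M S"
    if "graded_submodule G R M B K" and not: "\<not> Ann R M K \<subseteq> Ann R M S" for K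
  proof -
    obtain r where r: "r \<in> Ann R M K" "r \<notin> Ann R M S"
      using not by blast
    then have rR: "r \<in> carrier R"
      by (simp add: Ann_def)
    obtain g where g: "g \<in> carrier G" "RD.component r g \<notin> Ann R M S"
      using Ann_if_components[OF rR SC] r(2) by blast
    then show ?thesis
      using component_in_Ann[OF that(1) r(1) g(1)] RD.component_mem[OF rR g(1)]
      by (auto simp: homogeneous_def)
  qed
  assume "\<not> (Ann R M N \<subseteq> Ann R M S \<or> Ann R M N' \<subseteq> Ann R M S)"
  then obtain a b where a: "a \<in> Ann R M N" "a \<notin> Ann R M S"
    and b: "b \<in> homogeneous G A" "b \<in> Ann R M N'" "b \<notin> Ann R M S"
    using homog[OF N] homog[OF N'] by blast
  have R: "a \<in> carrier R" "b \<in> carrier R"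
    using a b by (auto simp: Ann_def)
  have "a \<otimes>\<^bsub>R\<^esub> b \<in> Ann R M N'"
    using mult_in_Ann[OF _ R(1) b(2)] N' by (simp add: graded_submodule_def)
  moreover have "a \<otimes>\<^bsub>R\<^esub> b \<in> Ann R M N"
    using mult_in_Ann[OF _ R(2) a(1)] N R.m_comm[OF R] by (simp add: graded_submodule_def)
  ultimately have ab: "a \<otimes>\<^bsub>R\<^esub> b \<in> Ann R M S"
    using sub by blast
  have "(\<lambda>x. b \<odot>\<^bsub>M\<^esub> x) ` S \<noteq> {\<zero>\<^bsub>M\<^esub>}"
    using b(3) R(2) by (auto simp: Ann_def)
  then have bS: "(\<lambda>x. b \<odot>\<^bsub>M\<^esub> x) ` S = S"
    using S b(1) by (auto simp: graded_second_def)
  have "a \<odot>\<^bsub>M\<^esub> (b \<odot>\<^bsub>M\<^esub> y) = \<zero>\<^bsub>M\<^esub>" if "y \<in> S" for y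
    using ab that SC R M.smult_assoc1[of a b y] by (auto simp: Ann_def)
  then have "\<forall>n\<in>(\<lambda>x. b \<odot>\<^bsub>M\<^esub> x) ` S. a \<odot>\<^bsub>M\<^esub> n = \<zero>\<^bsub>M\<^esub>"
    by blast
  then have "a \<in> Ann R M S"
    unfolding bS using R(1) by (simp add: Ann_def)
  with a(2) show False ..
qed

section \<open>Sums of graded submodules\<close>

lemma member_subset_submodule_sum:
  assumes "S \<in> \<N>" "S \<subseteq> carrier M"
  shows "S \<subseteq> submodule_sum M \<N>"
proof
  fix x assume "x \<in> S"
  then have "x = (\<Oplus>\<^bsub>M\<^esub>T\<in>{S}. x)"
    using assms by auto
  then show "x \<in> submodule_sum M \<N>"
    unfolding submodule_sum_def using assms(1) \<open>x \<in> S\<close> by (intro CollectI exI[of _ "{S}"]) auto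
qed

lemma submodule_sum_mono: "\<N> \<subseteq> \<N>' \<Longrightarrow> submodule_sum M \<N> \<subseteq> submodule_sum M \<N>'"
  unfolding submodule_sum_def by blast

lemma selection_closed:
  assumes "\<And>S. S \<in> \<N> \<Longrightarrow> submodule S R M" "F \<subseteq> \<N>" "f \<in> (\<Pi> S\<in>F. S)"
  shows "f \<in> F \<rightarrow> carrier M"
proof
  fix S assume "S \<in> F"
  then show "f S \<in> carrier M"
    using submodule_closed[OF assms(1)] assms(2,3) by (meson Pi_mem subsetD)
qed

lemma submodule_sum_add:
  assumes sub: "\<And>S. S \<in> \<N> \<Longrightarrow> submodule S R M"
    and x: "x \<in> submodule_sum M \<N>" and y: "y \<in> submodule_sum M \<N>"
  shows "x \<oplus>\<^bsub>M\<^esub> y \<in> submodule_sum M \<N>"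
proof -
  \<comment> \<open>The two summands may be given over different finite subfamilies; padding with
    zeros moves both to the union, where they add termwise.\<close>
  have extend: "\<exists>f. f \<in> (\<Pi> S\<in>H. S) \<and> z = (\<Oplus>\<^bsub>M\<^esub>S\<in>H. f S)"
    if "finite H" "F \<subseteq> H" "H \<subseteq> \<N>" "f \<in> (\<Pi> S\<in>F. S)" "z = (\<Oplus>\<^bsub>M\<^esub>S\<in>F. f S)" for H F f z
  proof (intro exI conjI)
    let ?f = "\<lambda>S. if S \<in> F then f S else \<zero>\<^bsub>M\<^esub>"
    show f: "?f \<in> (\<Pi> S\<in>H. S)"
      using that sub submodule_zero by (auto simp: Pi_iff)
    have "?f \<in> H \<rightarrow> carrier M"
      using selection_closed[OF sub that(3) f] .
    then show "z = (\<Oplus>\<^bsub>M\<^esub>S\<in>H. ?f S)"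
      unfolding that(5) by (intro M.M.add.finprod_mono_neutral_cong_left) (use that in auto)
  qed
  obtain F f where F: "finite F" "F \<subseteq> \<N>" "f \<in> (\<Pi> S\<in>F. S)" "x = (\<Oplus>\<^bsub>M\<^esub>S\<in>F. f S)"
    using x unfolding submodule_sum_def by blast
  obtain F' f' where F': "finite F'" "F' \<subseteq> \<N>" "f' \<in> (\<Pi> S\<in>F'. S)" "y = (\<Oplus>\<^bsub>M\<^esub>S\<in>F'. f' S)"
    using y unfolding submodule_sum_def by blast
  let ?H = "F \<union> F'"
  have H: "finite ?H" "?H \<subseteq> \<N>"
    using F F' by auto
  obtain h where h: "h \<in> (\<Pi> S\<in>?H. S)" "x = (\<Oplus>\<^bsub>M\<^esub>S\<in>?H. h S)"
    using extend[OF H(1) _ H(2) F(3,4)] by blast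
  obtain h' where h': "h' \<in> (\<Pi> S\<in>?H. S)" "y = (\<Oplus>\<^bsub>M\<^esub>S\<in>?H. h' S)"
    using extend[OF H(1) _ H(2) F'(3,4)] by blast
  have "h \<in> ?H \<rightarrow> carrier M" "h' \<in> ?H \<rightarrow> carrier M"
    using selection_closed[OF sub H(2)] h(1) h'(1) by auto
  then have "x \<oplus>\<^bsub>M\<^esub> y = (\<Oplus>\<^bsub>M\<^esub>S\<in>?H. h S \<oplus>\<^bsub>M\<^esub> h' S)"
    using M.M.finsum_addf[of h ?H h'] h(2) h'(2) by simp
  moreover have "(\<lambda>S. h S \<oplus>\<^bsub>M\<^esub> h' S) \<in> (\<Pi> S\<in>?H. S)"
  proof
    fix S assume "S \<in> ?H"
    then show "h S \<oplus>\<^bsub>M\<^esub> h' S \<in> S"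
      using M.submoduleE(5)[OF sub] H(2) h(1) h'(1) by (meson Pi_mem subsetD)
  qed
  ultimately show ?thesis
    unfolding submodule_sum_def using H by blast
qed

text \<open>An additive map that preserves every member of the family preserves their sum. It is
  applied to multiplication by a scalar and to the projection onto a homogeneous component.\<close>

lemma submodule_sum_image:
  assumes sub: "\<And>S. S \<in> \<N> \<Longrightarrow> submodule S R M"
    and hom: "\<And>(F :: 'm set set) f. finite F \<Longrightarrow> f \<in> F \<rightarrow> carrier M
        \<Longrightarrow> \<phi> (\<Oplus>\<^bsub>M\<^esub>S\<in>F. f S) = (\<Oplus>\<^bsub>M\<^esub>S\<in>F. \<phi> (f S))"
    and into: "\<And>S x. S \<in> \<N> \<Longrightarrow> x \<in> S \<Longrightarrow> \<phi> x \<in> S"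
    and x: "x \<in> submodule_sum M \<N>"
  shows "\<phi> x \<in> submodule_sum M \<N>"
proof -
  obtain F f where F: "finite F" "F \<subseteq> \<N>" "f \<in> (\<Pi> S\<in>F. S)" "x = (\<Oplus>\<^bsub>M\<^esub>S\<in>F. f S)"
    using x unfolding submodule_sum_def by blast
  have "f \<in> F \<rightarrow> carrier M"
    using selection_closed[OF sub F(2,3)] .
  then have "\<phi> x = (\<Oplus>\<^bsub>M\<^esub>S\<in>F. \<phi> (f S))"
    using hom F(1,4) by simp
  moreover have "(\<lambda>S. \<phi> (f S)) \<in> (\<Pi> S\<in>F. S)"
    using F(2,3) into by (auto simp: Pi_iff)
  ultimately show ?thesis
    unfolding submodule_sum_def using F(1,2) by blast
qed

lemma submodule_sum_subset:
  assumes sub: "\<And>S. S \<in> \<N> \<Longrightarrow> S \<subseteq> N" and N: "submodule N R M"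
  shows "submodule_sum M \<N> \<subseteq> N"
proof
  fix x assume "x \<in> submodule_sum M \<N>"
  then obtain F f where "finite F" "F \<subseteq> \<N>" "f \<in> (\<Pi> S\<in>F. S)" "x = (\<Oplus>\<^bsub>M\<^esub>S\<in>F. f S)"
    unfolding submodule_sum_def by blast
  then show "x \<in> N"
    using MD.subgroup_finsum_closed[OF submodule.axioms(1)[OF N], of F f] sub by blast
qed

lemma submodule_submodule_sum:
  assumes sub: "\<And>S. S \<in> \<N> \<Longrightarrow> submodule S R M"
  shows "submodule (submodule_sum M \<N>) R M"
proof -
  have sc: "submodule_sum M \<N> \<subseteq> carrier M"
    using submodule_sum_subset[OF _ M.carrier_is_submodule] submodule_closed sub by blast
  have smult: "a \<odot>\<^bsub>M\<^esub> x \<in> submodule_sum M \<N>"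
    if "a \<in> carrier R" "x \<in> submodule_sum M \<N>" for a x
    using submodule_sum_image[of \<N> "\<lambda>x. a \<odot>\<^bsub>M\<^esub> x"] M.finsum_smult_ldistr
      M.submoduleE(4)[OF sub] that sub by blast
  show ?thesis
  proof (rule M.submoduleI)
    show "\<zero>\<^bsub>M\<^esub> \<in> submodule_sum M \<N>"
      unfolding submodule_sum_def by (intro CollectI exI[of _ "{}"]) auto
    \<comment> \<open>Negation is multiplication by -1, so it is covered by closure under
      scalars.\<close>
    show "\<ominus>\<^bsub>M\<^esub> x \<in> submodule_sum M \<N>" if "x \<in> submodule_sum M \<N>" for x
      using smult[of "\<ominus>\<^bsub>R\<^esub> \<one>\<^bsub>R\<^esub>" x] that sc M.smult_l_minus[of "\<one>\<^bsub>R\<^esub>" x] by auto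
  qed (use sc smult submodule_sum_add sub in auto)
qed

lemma graded_submodule_submodule_sum:
  assumes "\<And>S. S \<in> \<N> \<Longrightarrow> graded_submodule G R M B S"
  shows "graded_submodule G R M B (submodule_sum M \<N>)"
proof -
  have sub: "submodule S R M" if "S \<in> \<N>" for S
    using assms that graded_submodule_def by blast
  have "MD.component x g \<in> submodule_sum M \<N>" if "x \<in> submodule_sum M \<N>" "g \<in> carrier G" for x g
    by (rule submodule_sum_image[where \<phi> = "\<lambda>x. MD.component x g"])
      (use sub that assms graded_submodule_iff MD.component_finsum in auto)
  then show ?thesis
    using submodule_submodule_sum[of \<N>] sub by (simp add: graded_submodule_iff)
qed

text \<open>A scalar kills a set of elements iff that set lies in this submodule. Annihilating a sum
  thus reduces to \<open>submodule_sum_subset\<close>.\<close>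

lemma submodule_annihilated:
  assumes "r \<in> carrier R"
  shows "submodule {x \<in> carrier M. r \<odot>\<^bsub>M\<^esub> x = \<zero>\<^bsub>M\<^esub>} R M"
proof (rule M.submoduleI)
  fix a x assume "a \<in> carrier R" "x \<in> {x \<in> carrier M. r \<odot>\<^bsub>M\<^esub> x = \<zero>\<^bsub>M\<^esub>}"
  then show "a \<odot>\<^bsub>M\<^esub> x \<in> {x \<in> carrier M. r \<odot>\<^bsub>M\<^esub> x = \<zero>\<^bsub>M\<^esub>}"
    using assms M.smult_assoc1[of r a x] M.smult_assoc1[of a r x] R.m_comm[of a r] by auto
qed (use assms in \<open>auto simp: M.smult_r_distr M.smult_r_minus\<close>)

text \<open>Membership of \<open>r\<close> in the carrier is a separate hypothesis because an empty
  family has no member to supply it.\<close>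

lemma Ann_submodule_sum:
  assumes "\<And>S. S \<in> \<N> \<Longrightarrow> S \<subseteq> carrier M" "r \<in> carrier R" "\<And>S. S \<in> \<N> \<Longrightarrow> r \<in> Ann R M S"
  shows "r \<in> Ann R M (submodule_sum M \<N>)"
proof -
  have "submodule_sum M \<N> \<subseteq> {x \<in> carrier M. r \<odot>\<^bsub>M\<^esub> x = \<zero>\<^bsub>M\<^esub>}"
    using assms by (intro submodule_sum_subset submodule_annihilated) (auto simp: Ann_def)
  then show ?thesis
    using assms(2) by (auto simp: Ann_def)
qed

section \<open>The Zariski topology\<close>

abbreviation Spec where "Spec \<equiv> second_spec G R A M B"
abbreviation V where "V \<equiv> second_variety G R A M B"

lemma Spec_graded: "S \<in> Spec \<Longrightarrow> graded_submodule G R M B S"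
  by (simp add: second_spec_def graded_second_def)

lemma Spec_submodule: "S \<in> Spec \<Longrightarrow> submodule S R M"
  using Spec_graded graded_submodule_def by blast

lemma Spec_closed: "S \<in> Spec \<Longrightarrow> S \<subseteq> carrier M"
  using Spec_submodule submodule_closed by blast

lemma variety_subset_Spec: "V N \<subseteq> Spec"
  by (auto simp: second_variety_def)

lemma variety_mono: "N \<subseteq> N' \<Longrightarrow> V N \<subseteq> V N'"
  using Ann_antimono[of N N'] unfolding second_variety_def by blast

lemma graded_submodule_sum_Spec:
  "C \<subseteq> Spec \<Longrightarrow> graded_submodule G R M B (submodule_sum M C)"
  using graded_submodule_submodule_sum Spec_graded by blast

lemma subset_variety_submodule_sum:
  assumes "C \<subseteq> Spec"
  shows "C \<subseteq> V (submodule_sum M C)"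
proof
  fix S assume S: "S \<in> C"
  then have "S \<subseteq> submodule_sum M C"
    using assms Spec_closed by (intro member_subset_submodule_sum) auto
  then show "S \<in> V (submodule_sum M C)"
    using assms S Ann_antimono by (auto simp: second_variety_def)
qed

text \<open>A scalar killing some \<open>N\<close> in the family kills every member of
  \<open>C\<close>, hence also their sum; so the variety of the sum lies in each \<open>V N\<close>.
  The explicit condition \<open>S\<close> in \<open>Spec\<close> makes the intersection of no
  varieties equal to \<open>Spec\<close>.\<close>

lemma Inter_varieties_eq_variety:
  assumes C: "C = {S \<in> Spec. \<forall>N\<in>\<K>. S \<in> V N}"
  shows "V (submodule_sum M C) = C"
proof
  have CS: "C \<subseteq> Spec"
    using C by blast
  then show "C \<subseteq> V (submodule_sum M C)"
    by (rule subset_variety_submodule_sum)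
  have "Ann R M N \<subseteq> Ann R M (submodule_sum M C)" if "N \<in> \<K>" for N
  proof
    fix r assume r: "r \<in> Ann R M N"
    show "r \<in> Ann R M (submodule_sum M C)"
    proof (rule Ann_submodule_sum)
      show "r \<in> carrier R"
        using r by (simp add: Ann_def)
    qed (use CS Spec_closed r that C in \<open>auto simp: second_variety_def\<close>)
  qed
  then show "V (submodule_sum M C) \<subseteq> C"
    unfolding C second_variety_def by auto
qed

text \<open>The intersection of a single variety: passing from \<open>N\<close> to its socle does
  not change the variety.\<close>

lemma variety_socle: "V (submodule_sum M (V N)) = V N"
  by (rule Inter_varieties_eq_variety[of _ "{N}"]) (auto simp: second_variety_def)

text \<open>A scalar killing both \<open>N\<close> and \<open>N'\<close> kills every member of the
  union, hence the sum. For \<open>S\<close> in the variety of the sum, \<open>Ann R M S\<close>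
  therefore contains the intersection of the two annihilators, and primeness puts \<open>S\<close>
  into one of the two varieties.\<close>

lemma Un_varieties_eq_variety:
  assumes N: "graded_submodule G R M B N" and N': "graded_submodule G R M B N'"
  shows "V (submodule_sum M (V N \<union> V N')) = V N \<union> V N'"
proof
  let ?C = "V N \<union> V N'"
  have CS: "?C \<subseteq> Spec"
    using variety_subset_Spec by blast
  then show "?C \<subseteq> V (submodule_sum M ?C)"
    by (rule subset_variety_submodule_sum)
  have "Ann R M N \<inter> Ann R M N' \<subseteq> Ann R M (submodule_sum M ?C)"
  proof
    fix r assume r: "r \<in> Ann R M N \<inter> Ann R M N'"
    show "r \<in> Ann R M (submodule_sum M ?C)"
    proof (rule Ann_submodule_sum)
      show "r \<in> carrier R"
        using r by (simp add: Ann_def)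
      show "S \<subseteq> carrier M" if "S \<in> ?C" for S
        using that CS Spec_closed by blast
    qed (use r in \<open>auto simp: second_variety_def\<close>)
  qed
  then show "V (submodule_sum M ?C) \<subseteq> ?C"
    using Ann_graded_second_prime[OF _ N N'] unfolding second_variety_def second_spec_def by blast
qed

section \<open>Open and closed sets\<close>

lemma istopology_zariski:
  "istopology (\<lambda>U. \<exists>N. graded_submodule G R M B N \<and> U = Spec - V N)"
  unfolding istopology_def
proof (intro conjI allI impI)
  fix U U' assume "\<exists>N. graded_submodule G R M B N \<and> U = Spec - V N"
    "\<exists>N. graded_submodule G R M B N \<and> U' = Spec - V N"
  then obtain N N' where N: "graded_submodule G R M B N" "graded_submodule G R M B N'"
    and U: "U = Spec - V N" "U' = Spec - V N'"
    by blast
  have "U \<inter> U' = Spec - V (submodule_sum M (V N \<union> V N'))"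
    unfolding Un_varieties_eq_variety[OF N] U by blast
  moreover have "graded_submodule G R M B (submodule_sum M (V N \<union> V N'))"
    using graded_submodule_sum_Spec variety_subset_Spec by blast
  ultimately show "\<exists>N. graded_submodule G R M B N \<and> U \<inter> U' = Spec - V N"
    by blast
next
  fix \<U> assume \<U>: "\<forall>U\<in>\<U>. \<exists>N. graded_submodule G R M B N \<and> U = Spec - V N"
  \<comment> \<open>All \<open>N\<close> whose variety has its complement in the family are taken at
    once, which avoids choosing one \<open>N\<close> for each open set. The sum of \<open>C\<close>
    is graded in any case.\<close>
  define C where "C = {S \<in> Spec. \<forall>N\<in>{N. Spec - V N \<in> \<U>}. S \<in> V N}"
  have "\<Union>\<U> = Spec - C"
  proof
    show "\<Union>\<U> \<subseteq> Spec - C"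
    proof
      fix S assume "S \<in> \<Union>\<U>"
      then obtain U where U: "U \<in> \<U>" "S \<in> U"
        by blast
      then obtain N where "U = Spec - V N"
        using \<U> by blast
      with U show "S \<in> Spec - C"
        by (auto simp: C_def)
    qed
    show "Spec - C \<subseteq> \<Union>\<U>"
      by (auto simp: C_def)
  qed
  then have "\<Union>\<U> = Spec - V (submodule_sum M C)"
    using Inter_varieties_eq_variety[OF C_def] by simp
  moreover have "graded_submodule G R M B (submodule_sum M C)"
    using graded_submodule_sum_Spec by (auto simp: C_def)
  ultimately show "\<exists>N. graded_submodule G R M B N \<and> \<Union>\<U> = Spec - V N"
    by blast
qed

lemma openin_zariski:
  "openin (zariski_topology G R A M B) U \<longleftrightarrow>
     (\<exists>N. graded_submodule G R M B N \<and> U = Spec - V N)"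
  unfolding zariski_topology_def using topology_inverse'[OF istopology_zariski] by simp

lemma topspace_zariski: "topspace (zariski_topology G R A M B) = Spec"
proof
  show "topspace (zariski_topology G R A M B) \<subseteq> Spec"
    using openin_zariski[of "topspace (zariski_topology G R A M B)"] by auto
  \<comment> \<open>The empty sum is the zero submodule. Its annihilator contains 1, which kills no
    second submodule since these are non-zero; so its variety is empty and \<open>Spec\<close> is
    open.\<close>
  let ?N = "submodule_sum M {}"
  have "V ?N = {}"
  proof -
    have "\<one>\<^bsub>R\<^esub> \<in> Ann R M ?N"
      by (rule Ann_submodule_sum) auto
    moreover have "\<one>\<^bsub>R\<^esub> \<notin> Ann R M S" if "S \<in> Spec" for S
    proof
      assume "\<one>\<^bsub>R\<^esub> \<in> Ann R M S"
      then have "S \<subseteq> {\<zero>\<^bsub>M\<^esub>}"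
        using Spec_closed[OF that] M.smult_one by (fastforce simp: Ann_def)
      then have "S = {\<zero>\<^bsub>M\<^esub>}"
        using submodule_zero[OF Spec_submodule[OF that]] by blast
      then show False
        using that by (simp add: second_spec_def graded_second_def)
    qed
    ultimately show ?thesis
      by (auto simp: second_variety_def)
  qed
  then have "openin (zariski_topology G R A M B) Spec"
    unfolding openin_zariski using graded_submodule_sum_Spec[of "{}"] by (intro exI[of _ ?N]) auto
  then show "Spec \<subseteq> topspace (zariski_topology G R A M B)"
    by (rule openin_subset)
qed

lemma closedin_zariski:
  "closedin (zariski_topology G R A M B) C \<longleftrightarrow> (\<exists>N. graded_submodule G R M B N \<and> C = V N)"
  unfolding closedin_def openin_zariski topspace_zariski using variety_subset_Spec by blast

end

section \<open>Transfer of the chain condition along injective monotone maps\<close>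

lemma descending_chain_condition_inj_mono:
  assumes "descending_chain_condition \<B>" "\<And>X. X \<in> \<A> \<Longrightarrow> f X \<in> \<B>"
    and "\<And>X Y. X \<in> \<A> \<Longrightarrow> Y \<in> \<A> \<Longrightarrow> X \<subseteq> Y \<Longrightarrow> f X \<subseteq> f Y" and "inj_on f \<A>"
  shows "descending_chain_condition \<A>"
  unfolding descending_chain_condition_def
proof (intro allI impI)
  fix C :: "nat \<Rightarrow> _" assume "range C \<subseteq> \<A> \<and> decseq C"
  then have C: "C n \<in> \<A>" and "decseq C" for n
    by auto
  then have "decseq (\<lambda>n. f (C n))" "range (\<lambda>n. f (C n)) \<subseteq> \<B>"
    using assms(2,3) by (auto simp: decseq_def)
  then obtain n where n: "\<forall>m\<ge>n. f (C m) = f (C n)"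
    using assms(1) unfolding descending_chain_condition_def by blast
  \<comment> \<open>The image chain is stationary from \<open>n\<close> on, and injectivity pulls
    this back to \<open>C\<close>.\<close>
  have "C m = C n" if "m \<ge> n" for m
    using inj_onD[OF assms(4) _ C C] n that by blast
  then show "\<exists>n. \<forall>m\<ge>n. C m = C n"
    by blast
qed

theorem theorem4p1:
  fixes G :: "('g, 'c) monoid_scheme" and R :: "('r, 'd) ring_scheme" and A :: "'g \<Rightarrow> 'r set"
    and M :: "('r, 'm, 'e) module_scheme" and B :: "'g \<Rightarrow> 'm set"
  assumes "graded_module G R A M B"
  shows "noetherian_space (zariski_topology G R A M B) \<longleftrightarrow>
    descending_chain_condition {N. zariski_socle_submodule G R A M B N}"
proof -
  interpret graded_module G R A M B
    by (fact assms)
  show ?thesis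
    unfolding noetherian_space_def
  proof
    assume "descending_chain_condition {C. closedin (zariski_topology G R A M B) C}"
    then show "descending_chain_condition {N. zariski_socle_submodule G R A M B N}"
    proof (rule descending_chain_condition_inj_mono[where f = V])
      show "inj_on V {N. zariski_socle_submodule G R A M B N}"
        \<comment> \<open>A socle submodule equals the sum of its variety by definition, so
          \<open>submodule_sum M\<close> is a left inverse of \<open>V\<close> on these
          submodules.\<close>
        by (rule inj_on_inverseI[of _ "submodule_sum M"])
          (simp add: zariski_socle_submodule_def zariski_socle_def)
    qed (auto simp: closedin_zariski zariski_socle_submodule_def dest: variety_mono)
  next
    assume "descending_chain_condition {N. zariski_socle_submodule G R A M B N}"
    then show "descending_chain_condition {C. closedin (zariski_topology G R A M B) C}"
    proof (rule descending_chain_condition_inj_mono[where f = "submodule_sum M"])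
      show "inj_on (submodule_sum M) {C. closedin (zariski_topology G R A M B) C}"
        \<comment> \<open>Closed sets are varieties, and \<open>variety_socle\<close> recovers a
          variety from its sum.\<close>
        by (rule inj_on_inverseI[of _ V]) (auto simp: closedin_zariski variety_socle)
      show "submodule_sum M C \<in> {N. zariski_socle_submodule G R A M B N}"
        if "C \<in> {C. closedin (zariski_topology G R A M B) C}" for C
        \<comment> \<open>For \<open>C = V N\<close> the sum is the socle of \<open>N\<close>. Its
          own variety is again \<open>V N\<close>, so it is its own socle.\<close>
        using that graded_submodule_sum_Spec[OF variety_subset_Spec] variety_socle
        by (auto simp: closedin_zariski zariski_socle_submodule_def zariski_socle_def)
    qed (rule submodule_sum_mono)
  qed
qed

end
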